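(* Let $f:\mathbb{R}^n\to\mathbb{R}$ be a non-convex differentiable function satisfying the $q$-coordinate Lipschitz gradient assumption with constants $L_J>0$, and let $\{x^m\}_{m\ge 0}$ be the random sequence generated by the $q$-RCCD algorithm, using the uniform distribution, for the problem $\min\{f(x): a^\top x=b,\ e_i\le x_i\le g_i,\ i\in[n]\}$. Then the sequence $\{f(x^m)\}$ converges almost surely to a random variable $\bar f$, and the sequence of random variables $\{M_q(x^m,\Gamma)\}$ converges to $0$ almost surely.
   Context: Setting. Let $n,q\in\mathbb{N}$ with $2\le q<n$, $[n]=\{1,\dots,n\}$, $a,e,g\in\mathbb{R}^n$ with $e\le g$ componentwise, $b\in\mathbb{R}$, and $P=\{x\in\mathbb{R}^n: a^\top x=b,\ e_i\le x_i\le g_i,\ i\in[n]\}$. Let $\mathcal{J}_q=\{J\subseteq[n]:|J|=q\}$. $\|\cdot\|$ is the Euclidean norm. $q$-coordinate Lipschitz gradient assumption. For every $J\in\mathcal{J}_q$ there is a constant $L_J>0$ (fixed throughout) such that $\|\nabla_J f(x+s_J)-\nabla_J f(x)\|\le L_J\|s_J\|$ for all $x\in\mathbb{R}^n$ and all $s_J\in\mathbb{R}^n$ whose entries outside $J$ are zero; here $\nabla_J f(x)\in\mathbb{R}^n$ has entries $\partial f(x)/\partial x_j$ for $j\in J$ and $0$ for $j\notin J$. $q$-RCCD algorithm (run without stopping). Start from some $x^0\in P$. At iteration $m=0,1,2,\dots$, draw $J_m\in\mathcal{J}_q$ uniformly at random, independently of the previous draws; let $u^m=(u^m_j)_{j\in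 J_m}$ be the unique minimizer of $\sum_{j\in J_m}\frac{\partial f(x^m)}{\partial x_j}(\bar u_j-x^m_j)+\frac{L_{J_m}}{2}\sum_{j\in J_m}(\bar u_j-x^m_j)^2$ subject to $\sum_{j\in J_m}a_j\bar u_j=\sum_{j\in J_m}a_jx^m_j$ and $e_j\le\bar u_j\le g_j$ for $j\in J_m$; let $d_{J_m}(x^m)\in\mathbb{R}^n$ have entries $u^m_j-x^m_j$ for $j\in J_m$ and $0$ otherwise; set $x^{m+1}=x^m+d_{J_m}(x^m)$. Stationarity measure. Let $\mu=\binom{n-1}{q-1}$, $\Gamma\in\mathbb{R}^n$ with $\Gamma_i=\frac1\mu\sum_{J\in\mathcal{J}_q:\,i\in J}L_J$, $D_\Gamma=\mathrm{Diag}(\Gamma)$, $\|x\|_\Gamma=(x^\top D_\Gamma x)^{1/2}$. For $x\in P$ let $S(x)=\{s\in\mathbb{R}^n: a^\top s=0,\ e\le s+x\le g\}$, let $d_{\mu\Gamma}(x)$ be the unique minimizer over $s\in S(x)$ of $\psi_{\mu\Gamma}(s;x)=f(x)+\langle\nabla f(x),s\rangle+\frac{\mu}{2}\|s\|_\Gamma^2$, and $M_q(x,\Gamma)=\|d_{\mu\Gamma}(x)\|_\Gamma$. *)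

theory Defs
  imports "HOL-Probability.Probability"
begin

(* Vectors of R^n are elements of real ^ 'n with n = CARD('n).
   No convexity is imposed on the objective f anywhere: "non-convex" is read
   as "not necessarily convex". *)

definition feasible_set ::
    "real ^ 'n \<Rightarrow> real \<Rightarrow> real ^ 'n \<Rightarrow> real ^ 'n \<Rightarrow> (real ^ 'n) set" where
  "feasible_set a b e g = {x. a \<bullet> x = b \<and> (\<forall>i. e $ i \<le> x $ i \<and> x $ i \<le> g $ i)}"

definition coord_sets :: "nat \<Rightarrow> 'n::finite set set" where
  "coord_sets q = {J. card J = q}"

definition partial_deriv :: "(real ^ 'n \<Rightarrow> real) \<Rightarrow> 'n \<Rightarrow> real ^ 'n \<Rightarrow> real" where
  "partial_deriv f j x = deriv (\<lambda>t. f (x + t *\<^sub>R axis j 1)) 0"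

definition grad :: "(real ^ 'n \<Rightarrow> real) \<Rightarrow> real ^ 'n \<Rightarrow> real ^ 'n" where
  "grad f x = (\<chi> j. partial_deriv f j x)"

definition grad_on :: "'n set \<Rightarrow> (real ^ 'n \<Rightarrow> real) \<Rightarrow> real ^ 'n \<Rightarrow> real ^ 'n" where
  "grad_on J f x = (\<chi> j. if j \<in> J then partial_deriv f j x else 0)"

definition coord_lipschitz_grad ::
    "nat \<Rightarrow> ('n set \<Rightarrow> real) \<Rightarrow> (real ^ 'n \<Rightarrow> real) \<Rightarrow> bool" where
  "coord_lipschitz_grad q L f \<longleftrightarrow>
     (\<forall>J \<in> coord_sets q. L J > 0 \<and>
        (\<forall>x s. (\<forall>j. j \<notin> J \<longrightarrow> s $ j = 0) \<longrightarrow>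
           norm (grad_on J f (x + s) - grad_on J f x) \<le> L J * norm s))"

(* The subproblem lives on families (u_j) indexed by J, encoded as functions that are
   undefined outside J. For x feasible and L J > 0 the objective is strictly convex and
   the constraint set is nonempty and compact, so arg_min is the unique minimizer. *)
definition block_minimizer ::
    "(real ^ 'n \<Rightarrow> real) \<Rightarrow> ('n set \<Rightarrow> real) \<Rightarrow> real ^ 'n \<Rightarrow> real ^ 'n \<Rightarrow> real ^ 'n \<Rightarrow>
     'n set \<Rightarrow> real ^ 'n \<Rightarrow> ('n \<Rightarrow> real)" where
  "block_minimizer f L a e g J x =
     arg_min
       (\<lambda>u. (\<Sum>j\<in>J. partial_deriv f j x * (u j - x $ j))
            + L J / 2 * (\<Sum>j\<in>J. (u j - x $ j)\<^sup>2))
       (\<lambda>u. u \<in> extensional J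
            \<and> (\<Sum>j\<in>J. a $ j * u j) = (\<Sum>j\<in>J. a $ j * x $ j)
            \<and> (\<forall>j\<in>J. e $ j \<le> u j \<and> u j \<le> g $ j))"

definition block_direction ::
    "(real ^ 'n \<Rightarrow> real) \<Rightarrow> ('n set \<Rightarrow> real) \<Rightarrow> real ^ 'n \<Rightarrow> real ^ 'n \<Rightarrow> real ^ 'n \<Rightarrow>
     'n set \<Rightarrow> real ^ 'n \<Rightarrow> real ^ 'n" where
  "block_direction f L a e g J x =
     (\<chi> j. if j \<in> J then block_minimizer f L a e g J x j - x $ j else 0)"

(* Iterates of the algorithm for a given realisation Js of the sequence of draws. *)
primrec rccd ::
    "(real ^ 'n \<Rightarrow> real) \<Rightarrow> ('n set \<Rightarrow> real) \<Rightarrow> real ^ 'n \<Rightarrow> real ^ 'n \<Rightarrow> real ^ 'n \<Rightarrow>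
     real ^ 'n \<Rightarrow> (nat \<Rightarrow> 'n set) \<Rightarrow> nat \<Rightarrow> real ^ 'n" where
  "rccd f L a e g x0 Js 0 = x0"
| "rccd f L a e g x0 Js (Suc m) =
     rccd f L a e g x0 Js m + block_direction f L a e g (Js m) (rccd f L a e g x0 Js m)"

definition Diag :: "real ^ 'n \<Rightarrow> real ^ 'n ^ 'n" where
  "Diag v = (\<chi> i j. if i = j then v $ i else 0)"

definition weighted_norm :: "real ^ 'n \<Rightarrow> real ^ 'n \<Rightarrow> real" where
  "weighted_norm \<Gamma> x = sqrt (x \<bullet> (Diag \<Gamma> *v x))"

definition mu_const :: "'n::finite itself \<Rightarrow> nat \<Rightarrow> real" where
  "mu_const _ q = real ((CARD('n) - 1) choose (q - 1))"

definition Gamma_vec :: "nat \<Rightarrow> ('n set \<Rightarrow> real) \<Rightarrow> real ^ 'n" where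
  "Gamma_vec q L =
     (\<chi> i. (\<Sum>J\<in>{J \<in> coord_sets q. i \<in> J}. L J) / mu_const TYPE('n) q)"

definition feasible_directions ::
    "real ^ 'n \<Rightarrow> real ^ 'n \<Rightarrow> real ^ 'n \<Rightarrow> real ^ 'n \<Rightarrow> (real ^ 'n) set" where
  "feasible_directions a e g x =
     {s. a \<bullet> s = 0 \<and> (\<forall>i. e $ i \<le> s $ i + x $ i \<and> s $ i + x $ i \<le> g $ i)}"

definition psi ::
    "(real ^ 'n \<Rightarrow> real) \<Rightarrow> real \<Rightarrow> real ^ 'n \<Rightarrow> real ^ 'n \<Rightarrow> real ^ 'n \<Rightarrow> real" where
  "psi f \<mu> \<Gamma> s x = f x + grad f x \<bullet> s + \<mu> / 2 * (weighted_norm \<Gamma> s)\<^sup>2"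

(* As for block_minimizer, the minimizer is unique for feasible x when \<mu> and all
   entries of \<Gamma> are positive. *)
definition full_direction ::
    "(real ^ 'n \<Rightarrow> real) \<Rightarrow> real ^ 'n \<Rightarrow> real ^ 'n \<Rightarrow> real ^ 'n \<Rightarrow> real \<Rightarrow> real ^ 'n \<Rightarrow>
     real ^ 'n \<Rightarrow> real ^ 'n" where
  "full_direction f a e g \<mu> \<Gamma> x =
     arg_min (\<lambda>s. psi f \<mu> \<Gamma> s x) (\<lambda>s. s \<in> feasible_directions a e g x)"

definition stationarity_measure ::
    "(real ^ 'n \<Rightarrow> real) \<Rightarrow> real ^ 'n \<Rightarrow> real ^ 'n \<Rightarrow> real ^ 'n \<Rightarrow> nat \<Rightarrow> real ^ 'n \<Rightarrow>
     real ^ 'n \<Rightarrow> real" where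
  "stationarity_measure f a e g q \<Gamma> x =
     weighted_norm \<Gamma> (full_direction f a e g (mu_const TYPE('n) q) \<Gamma> x)"

end

theory Submission imports Defs begin

text \<open>
  The whole argument is driven by the decrease of \<open>f\<close> that a block update achieves.  For a
  feasible \<open>x\<close> write \<open>\<Delta>\<^sub>S(x) = f x - f (x + d\<^sub>S(x))\<close>, and let \<open>D(x)\<close> be the sum of
  \<open>\<Delta>\<^sub>S(x)\<close> over all blocks \<open>S\<close> of size \<open>q\<close>.

  The descent lemma for block-Lipschitz gradients says that the quadratic model minimised in
  block \<open>S\<close> majorises \<open>f\<close>, so \<open>\<Delta>\<^sub>S(x)\<close> is at least the decrease predicted by that model for
  any feasible direction supported in \<open>S\<close> (\<open>block_decrease_ge_model\<close>).  The zero direction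
  gives \<open>\<Delta>\<^sub>S(x) \<ge> 0\<close>; hence \<open>f (X m)\<close> is decreasing almost surely, and it converges because
  \<open>f\<close> is bounded on the compact feasible set.

  The stationarity measure is controlled by the same quantity: \<open>M_q(x)\<^sup>2 \<le> C * D(x)\<close> on the
  feasible set (\<open>stationarity_le_total_decrease\<close>).  The full direction \<open>d\<close> moves all
  coordinates at once, but a vector of the hyperplane orthogonal to \<open>a\<close> is a sum of at most
  \<open>n\<close> vectors of that hyperplane with at most two nonzero entries, each lying
  coordinatewise between \<open>0\<close> and \<open>d\<close> (\<open>conformal_decomposition\<close>).  Each piece \<open>s\<close> therefore
  respects the box and fits into a block since \<open>q \<ge> 2\<close>, and comparing the block minimiser
  with \<open>t * s\<close> for a small fixed \<open>t\<close> bounds \<open>- \<langle>\<nabla>f(x), s\<rangle>\<close> by \<open>\<Delta>\<^sub>S(x) / t\<close> plus a multiple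
  of \<open>t * norm d ^ 2\<close>.  Summed over the pieces, the latter is absorbed by the
  inequality \<open>\<mu>/2 * M_q(x)\<^sup>2 \<le> - \<langle>\<nabla>f(x), d\<rangle>\<close>, which holds because \<open>d\<close> beats the zero
  direction in its own model.

  Finally, \<open>X m\<close> depends only on the draws before \<open>m\<close> and so is independent of \<open>J m\<close>.
  With \<open>N\<close> the number of blocks, this gives \<open>E D(X m) = N * (E f(X m) - E f(X (m+1)))\<close>
  (\<open>expectation_uniform_draw\<close>).  These expectations telescope to a bounded sum of
  nonnegative terms, so \<open>D(X m)\<close> tends to \<open>0\<close> almost surely, and \<open>M_q(X m)\<close> with it.
\<close>

section \<open>Conformal decomposition in a hyperplane\<close>

definition support :: "real ^ 'n \<Rightarrow> 'n set" where
  "support d = {i. d $ i \<noteq> 0}"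

text \<open>
  Sign agreement and domination in absolute value are expressed together: every entry of \<open>s\<close>
  lies in the interval spanned by \<open>0\<close> and the corresponding entry of \<open>d\<close>.  Box constraints
  satisfied at \<open>x\<close> and \<open>x + d\<close> are thereby inherited by \<open>x + s\<close>.
\<close>
definition conformal :: "real ^ 'n \<Rightarrow> real ^ 'n \<Rightarrow> bool" where
  "conformal s d \<longleftrightarrow> (\<forall>i. min 0 (d $ i) \<le> s $ i \<and> s $ i \<le> max 0 (d $ i))"

lemma conformal_trans: "conformal r s \<Longrightarrow> conformal s d \<Longrightarrow> conformal r d"
  unfolding conformal_def by (smt (verit) max_def min_def)

lemma conformal_diff: "conformal s d \<Longrightarrow> conformal (d - s) d"
  unfolding conformal_def by (auto simp: min_def max_def split: if_splits)

lemma conformal_coordinate_scaling: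
  assumes "\<And>i. 0 \<le> \<theta> i \<and> \<theta> i \<le> 1"
  shows "conformal (\<chi> i. \<theta> i * d $ i) d"
  unfolding conformal_def
proof
  fix i
  have *: "0 \<le> \<theta> i" "\<theta> i \<le> 1" using assms by auto
  show "min 0 (d $ i) \<le> (\<chi> i. \<theta> i * d $ i) $ i \<and> (\<chi> i. \<theta> i * d $ i) $ i \<le> max 0 (d $ i)"
  proof (cases "0 \<le> d $ i")
    case True
    then show ?thesis using * mult_right_mono[of "\<theta> i" 1 "d $ i"] by (simp add: min_def max_def)
  next
    case False
    then show ?thesis using * mult_right_mono_neg[of "\<theta> i" 1 "d $ i"]
      by (simp add: min_def max_def mult_nonneg_nonpos)
  qed
qed

lemma conformal_norm_le: "conformal s d \<Longrightarrow> norm s \<le> norm d"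
  by (rule norm_le_componentwise_cart) (smt (verit) conformal_def real_norm_def)

lemma conformal_feasible_direction:
  assumes "conformal s d" "a \<bullet> s = 0" "x \<in> feasible_set a b e g" "d \<in> feasible_directions a e g x"
  shows "s \<in> feasible_directions a e g x"
proof -
  have "e $ i \<le> s $ i + x $ i \<and> s $ i + x $ i \<le> g $ i" for i
  proof -
    have "min 0 (d $ i) \<le> s $ i" "s $ i \<le> max 0 (d $ i)" using assms(1) by (auto simp: conformal_def)
    moreover have "e $ i \<le> x $ i" "x $ i \<le> g $ i" using assms(3) by (auto simp: feasible_set_def)
    moreover have "e $ i \<le> d $ i + x $ i" "d $ i + x $ i \<le> g $ i"
      using assms(4) by (auto simp: feasible_directions_def)
    ultimately show ?thesis by (auto simp: min_def max_def split: if_splits)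
  qed
  then show ?thesis using assms(2) by (simp add: feasible_directions_def)
qed

text \<open>
  The terms \<open>a\<^sub>k d\<^sub>k\<close> sum to zero.  If one of them vanishes although \<open>d\<^sub>k \<noteq> 0\<close>, that coordinate
  can be split off alone.  Otherwise there is a positive term \<open>p\<^sub>i\<close> and a negative term \<open>p\<^sub>j\<close>;
  scaling both to the smaller absolute value makes them cancel and uses up one of the two
  coordinates completely, so the remainder has strictly smaller support.
\<close>
lemma conformal_elementary_step:
  fixes a d :: "real ^ 'n"
  assumes orth: "a \<bullet> d = 0" and nz: "d \<noteq> 0"
  shows "\<exists>s. a \<bullet> s = 0 \<and> conformal s d \<and> card (support s) \<le> 2 \<and> support (d - s) \<subset> support d"
proof (cases "\<exists>i. d $ i \<noteq> 0 \<and> a $ i = 0")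
  case True
  then obtain i where i: "d $ i \<noteq> 0" "a $ i = 0" by auto
  define s where "s = (\<chi> k. (if k = i then 1 else 0) * d $ k)"
  have "conformal s d" unfolding s_def by (rule conformal_coordinate_scaling) auto
  moreover have "support s = {i}" using i by (auto simp: support_def s_def)
  moreover have "a \<bullet> s = 0" using i by (auto simp: inner_vec_def s_def intro!: sum.neutral)
  moreover have "support (d - s) \<subset> support d" using i by (auto simp: support_def s_def)
  ultimately show ?thesis by (intro exI[of _ s]) simp
next
  case False
  define p where "p k = a $ k * d $ k" for k
  have sum_p: "sum p UNIV = 0" using orth by (simp add: p_def inner_vec_def)
  have p_nz: "p k \<noteq> 0 \<longleftrightarrow> d $ k \<noteq> 0" for k using False by (auto simp: p_def)
  obtain k where k: "p k \<noteq> 0" using nz p_nz by (auto simp: vec_eq_iff)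
  have "\<exists>i. p i > 0"
  proof (rule ccontr)
    assume "\<not> ?thesis"
    then have "\<forall>i. 0 \<le> - p i" by (auto simp: not_less)
    moreover have "(\<Sum>i\<in>UNIV. - p i) = 0" using sum_p by (simp add: sum_negf)
    ultimately show False using sum_nonneg_eq_0_iff[of UNIV "\<lambda>i. - p i"] k by auto
  qed
  moreover have "\<exists>j. p j < 0"
  proof (rule ccontr)
    assume "\<not> ?thesis"
    then show False using sum_p sum_nonneg_eq_0_iff[of UNIV p] k by (auto simp: not_less)
  qed
  ultimately obtain i j where ij: "p i > 0" "p j < 0" by auto
  then have "i \<noteq> j" by auto
  define \<delta> where "\<delta> = min (p i) (- p j)"
  define \<theta> where "\<theta> k = (if k = i then \<delta> / p i else if k = j then \<delta> / (- p j) else 0)" for k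
  define s where "s = (\<chi> k. \<theta> k * d $ k)"
  have "\<delta> > 0" using ij by (simp add: \<delta>_def)
  then have \<theta>: "0 \<le> \<theta> k \<and> \<theta> k \<le> 1" for k
    using ij by (auto simp: \<theta>_def divide_simps \<delta>_def)
  have "conformal s d" unfolding s_def using \<theta> by (rule conformal_coordinate_scaling)
  moreover have supp: "support s \<subseteq> {i, j}" by (auto simp: support_def s_def \<theta>_def)
  then have "card (support s) \<le> 2"
    using card_mono[OF _ supp] \<open>i \<noteq> j\<close> by simp
  moreover have "a \<bullet> s = 0"
  proof -
    have "a \<bullet> s = (\<Sum>k\<in>UNIV. \<theta> k * p k)"
      by (simp add: inner_vec_def s_def p_def algebra_simps)
    also have "\<dots> = (\<Sum>k\<in>{i, j}. \<theta> k * p k)"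
      by (rule sum.mono_neutral_right) (auto simp: \<theta>_def)
    also have "\<dots> = 0" using ij \<open>i \<noteq> j\<close> by (simp add: \<theta>_def)
    finally show ?thesis .
  qed
  moreover have "support (d - s) \<subset> support d"
  proof -
    have "support (d - s) \<subseteq> support d" by (auto simp: support_def s_def)
    moreover have "\<exists>k\<in>support d. k \<notin> support (d - s)"
    proof (cases "p i \<le> - p j")
      case True
      then show ?thesis using ij p_nz[of i] by (intro bexI[of _ i]) (auto simp: support_def s_def \<theta>_def \<delta>_def)
    next
      case False
      then show ?thesis using ij p_nz[of j] \<open>i \<noteq> j\<close>
        by (intro bexI[of _ j]) (auto simp: support_def s_def \<theta>_def \<delta>_def)
    qed
    ultimately show ?thesis by blast
  qed
  ultimately show ?thesis by blast
qed

lemma conformal_decomposition: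
  fixes a d :: "real ^ 'n"
  assumes "a \<bullet> d = 0"
  shows "\<exists>ss. length ss \<le> card (support d) \<and> sum_list ss = d \<and>
           (\<forall>s\<in>set ss. a \<bullet> s = 0 \<and> conformal s d \<and> card (support s) \<le> 2)"
  using assms
proof (induction "card (support d)" arbitrary: d rule: less_induct)
  case less
  show ?case
  proof (cases "d = 0")
    case True
    then show ?thesis by (intro exI[of _ "[]"]) simp
  next
    case False
    then obtain s where s: "a \<bullet> s = 0" "conformal s d" "card (support s) \<le> 2"
      "support (d - s) \<subset> support d"
      using conformal_elementary_step[OF less.prems] by blast
    have lt: "card (support (d - s)) < card (support d)" by (rule psubset_card_mono) (use s in auto)
    have "a \<bullet> (d - s) = 0" using less.prems s by (simp add: inner_diff_right)
    from less.hyps[OF lt this] obtain ss where ss: "length ss \<le> card (support (d - s))"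
      "sum_list ss = d - s" "\<forall>r\<in>set ss. a \<bullet> r = 0 \<and> conformal r (d - s) \<and> card (support r) \<le> 2"
      by blast
    then show ?thesis using s lt conformal_diff[OF s(2)]
      by (intro exI[of _ "s # ss"]) (auto intro: conformal_trans)
  qed
qed

section \<open>The descent lemma on a block\<close>

lemma has_derivative_grad:
  fixes f :: "real ^ 'n \<Rightarrow> real"
  assumes "f differentiable (at x)"
  shows "(f has_derivative (\<lambda>v. grad f x \<bullet> v)) (at x)"
proof -
  obtain D where D: "(f has_derivative D) (at x)" using assms by (auto simp: differentiable_def)
  have lin: "linear D" using D by (rule has_derivative_linear)
  have pd: "partial_deriv f j x = D (axis j 1)" for j
  proof -
    have "((\<lambda>t::real. x + t *\<^sub>R axis j 1) has_derivative (\<lambda>t. t *\<^sub>R axis j 1)) (at 0)"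
      by (auto intro!: derivative_eq_intros)
    moreover have "(f has_derivative D) (at (x + 0 *\<^sub>R axis j 1))" using D by simp
    ultimately have "((\<lambda>t. f (x + t *\<^sub>R axis j 1)) has_derivative (\<lambda>t. D (t *\<^sub>R axis j 1))) (at 0)"
      by (rule has_derivative_compose)
    then have "((\<lambda>t. f (x + t *\<^sub>R axis j 1)) has_real_derivative D (axis j 1)) (at 0)"
      unfolding has_field_derivative_def
      by (simp add: linear_scale[OF lin] mult_commute_abs)
    then show ?thesis unfolding partial_deriv_def by (rule DERIV_imp_deriv)
  qed
  have "D v = grad f x \<bullet> v" for v
  proof -
    have "D v = D (\<Sum>i\<in>UNIV. v $ i *s axis i 1)" by (simp add: basis_expansion)
    also have "\<dots> = (\<Sum>i\<in>UNIV. v $ i * D (axis i 1))"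
      by (simp add: linear_sum[OF lin] linear_scale[OF lin] scalar_mult_eq_scaleR)
    also have "\<dots> = grad f x \<bullet> v" by (simp add: inner_vec_def grad_def pd mult.commute)
    finally show ?thesis .
  qed
  then show ?thesis using D by presburger
qed

lemma grad_on_inner: "support s \<subseteq> S \<Longrightarrow> grad_on S f x \<bullet> s = grad f x \<bullet> s"
  by (auto simp: inner_vec_def grad_on_def grad_def support_def intro!: sum.cong)

text \<open>
  Along the segment from \<open>x\<close> to \<open>x + s\<close> the slope exceeds its initial value by at most
  \<open>L S * t * (norm s)\<^sup>2\<close>, because moving inside the block changes the block gradient at Lipschitz
  rate \<open>L S\<close>.  Subtracting the integral of this bound leaves a nonincreasing function of \<open>t\<close>.
\<close>
lemma block_descent:
  fixes f :: "real ^ 'n \<Rightarrow> real"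
  assumes diff: "\<forall>x. f differentiable (at x)"
    and lip: "coord_lipschitz_grad q L f"
    and S: "S \<in> coord_sets q" and s: "support s \<subseteq> S"
  shows "f (x + s) \<le> f x + grad f x \<bullet> s + L S / 2 * (norm s)\<^sup>2"
proof -
  define h where "h t = f (x + t *\<^sub>R s) - t * (grad f x \<bullet> s) - L S / 2 * t\<^sup>2 * (norm s)\<^sup>2" for t
  have der: "(h has_real_derivative
      grad f (x + t *\<^sub>R s) \<bullet> s - grad f x \<bullet> s - L S * t * (norm s)\<^sup>2) (at t)" for t
  proof -
    have "((\<lambda>t::real. x + t *\<^sub>R s) has_derivative (\<lambda>t. t *\<^sub>R s)) (at t)"
      by (auto intro!: derivative_eq_intros)
    from has_derivative_compose[OF this has_derivative_grad[OF diff[rule_format]]]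
    have "((\<lambda>t. f (x + t *\<^sub>R s)) has_real_derivative grad f (x + t *\<^sub>R s) \<bullet> s) (at t)"
      by (simp add: has_field_derivative_def mult_commute_abs)
    then show ?thesis unfolding h_def
      by (auto intro!: derivative_eq_intros)
  qed
  have neg: "grad f (x + t *\<^sub>R s) \<bullet> s - grad f x \<bullet> s - L S * t * (norm s)\<^sup>2 \<le> 0" if "0 \<le> t" for t
  proof -
    have "\<forall>j. j \<notin> S \<longrightarrow> (t *\<^sub>R s) $ j = 0" using s by (auto simp: support_def)
    then have "norm (grad_on S f (x + t *\<^sub>R s) - grad_on S f x) \<le> L S * norm (t *\<^sub>R s)"
      using lip[unfolded coord_lipschitz_grad_def, rule_format, OF S] by blast
    then have "norm (grad_on S f (x + t *\<^sub>R s) - grad_on S f x) * norm s \<le> L S * t * (norm s)\<^sup>2"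
      using that mult_right_mono[of _ _ "norm s"] by (fastforce simp: power2_eq_square)
    moreover have "grad f (x + t *\<^sub>R s) \<bullet> s - grad f x \<bullet> s
        = (grad_on S f (x + t *\<^sub>R s) - grad_on S f x) \<bullet> s"
      using s by (simp add: inner_diff_left grad_on_inner)
    ultimately show ?thesis using norm_cauchy_schwarz order_trans by fastforce
  qed
  have "h 1 \<le> h 0"
  proof (rule DERIV_nonpos_imp_nonincreasing[of 0 1 h])
    show "\<exists>y. (h has_real_derivative y) (at t) \<and> y \<le> 0" if "0 \<le> t" "t \<le> 1" for t
      using der neg[OF that(1)] by blast
  qed simp
  then show ?thesis by (simp add: h_def)
qed

section \<open>Block minimisers and the decrease they achieve\<close>

lemma compact_feasible_set: "compact (feasible_set a b e g)"
proof -
  have "feasible_set a b e g = cbox e g \<inter> {x. a \<bullet> x = b}"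
    by (auto simp: feasible_set_def mem_box_cart)
  then show ?thesis by (simp add: compact_Int_closed closed_hyperplane)
qed

lemma compact_feasible_directions:
  fixes a e g x :: "real ^ 'n"
  shows "compact (feasible_directions a e g x)"
proof -
  have "feasible_directions a e g x = cbox (e - x) (g - x) \<inter> {s. a \<bullet> s = 0}"
    by (auto simp: feasible_directions_def mem_box_cart algebra_simps)
  then show ?thesis by (simp add: compact_Int_closed closed_hyperplane)
qed

lemma zero_feasible_direction:
  "x \<in> feasible_set a b e g \<Longrightarrow> 0 \<in> feasible_directions a e g x"
  by (simp add: feasible_set_def feasible_directions_def)

lemma feasible_step:
  "x \<in> feasible_set a b e g \<Longrightarrow> s \<in> feasible_directions a e g x \<Longrightarrow> x + s \<in> feasible_set a b e g"
  by (simp add: feasible_set_def feasible_directions_def inner_add_right add.commute)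

lemma is_arg_min_arg_min:
  "is_arg_min \<phi> Q u \<Longrightarrow> is_arg_min \<phi> Q (arg_min \<phi> Q)"
  unfolding arg_min_def by (rule someI)

text \<open>
  The block subproblem is posed over families indexed by \<open>S\<close>, and \<open>arg_min\<close> is only meaningful
  once a minimiser is known to exist.  Translating a family \<open>u\<close> into the displacement
  \<open>dir u\<close>, extended by zero, identifies the constraint set with a compact set of
  vectors, on which the continuous model attains its minimum.  Existence is a matter of compactness and not of convexity, so the
  statement covers arbitrary \<open>S\<close>, and the iterates stay feasible for every realisation of the
  draws and not only almost surely.
\<close>
lemma block_direction_minimal:
  fixes x :: "real ^ 'n" and f :: "real ^ 'n \<Rightarrow> real" and L :: "'n set \<Rightarrow> real" and S :: "'n set"
  assumes x: "x \<in> feasible_set a b e g"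
  defines "d \<equiv> block_direction f L a e g S x"
  shows "d \<in> feasible_directions a e g x" and "support d \<subseteq> S"
    and "\<And>s. s \<in> feasible_directions a e g x \<Longrightarrow> support s \<subseteq> S \<Longrightarrow>
           grad f x \<bullet> d + L S / 2 * (norm d)\<^sup>2 \<le> grad f x \<bullet> s + L S / 2 * (norm s)\<^sup>2"
proof -
  define B where "B = feasible_directions a e g x \<inter> {s. support s \<subseteq> S}"
  define model where "model s = grad f x \<bullet> s + L S / 2 * (norm s)\<^sup>2" for s :: "real ^ 'n"
  define \<phi> where "\<phi> u = (\<Sum>j\<in>S. partial_deriv f j x * (u j - x $ j))
            + L S / 2 * (\<Sum>j\<in>S. (u j - x $ j)\<^sup>2)" for u
  define Q where "Q u \<longleftrightarrow> u \<in> extensional S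
            \<and> (\<Sum>j\<in>S. a $ j * u j) = (\<Sum>j\<in>S. a $ j * x $ j)
            \<and> (\<forall>j\<in>S. e $ j \<le> u j \<and> u j \<le> g $ j)" for u
  define dir :: "('n \<Rightarrow> real) \<Rightarrow> real ^ 'n" where "dir u = (\<chi> j. if j \<in> S then u j - x $ j else 0)" for u
  define pt where "pt s = (\<lambda>j\<in>S. x $ j + s $ j)" for s :: "real ^ 'n"
  have box: "e $ j \<le> x $ j" "x $ j \<le> g $ j" for j using x by (auto simp: feasible_set_def)
  have sum_S: "(\<Sum>j\<in>UNIV. if j \<in> S then h j else 0) = (\<Sum>j\<in>S. h j)" for h :: "'n \<Rightarrow> real"
    by (simp add: sum.If_cases)
  have model_dir: "model (dir u) = \<phi> u" for u
  proof -
    have "grad f x \<bullet> dir u = (\<Sum>j\<in>S. partial_deriv f j x * (u j - x $ j))"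
      unfolding sum_S[symmetric] by (auto simp: inner_vec_def grad_def dir_def intro!: sum.cong)
    moreover have "(norm (dir u))\<^sup>2 = (\<Sum>j\<in>S. (u j - x $ j)\<^sup>2)"
      unfolding sum_S[symmetric] power2_norm_eq_inner
      by (auto simp: inner_vec_def dir_def power2_eq_square intro!: sum.cong)
    ultimately show ?thesis by (simp add: model_def \<phi>_def)
  qed
  have inner_dir: "a \<bullet> dir u = (\<Sum>j\<in>S. a $ j * u j) - (\<Sum>j\<in>S. a $ j * x $ j)" for u
    unfolding sum_subtractf[symmetric] sum_S[symmetric]
    by (auto simp: inner_vec_def dir_def algebra_simps intro!: sum.cong)
  have dir_B: "dir u \<in> B" if "Q u" for u
  proof -
    have "a \<bullet> dir u = 0" using that by (simp add: inner_dir Q_def)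
    then show ?thesis using that box unfolding B_def feasible_directions_def
      by (auto simp: Q_def support_def) (auto simp: dir_def split: if_splits)
  qed
  have dir_pt: "dir (pt s) = s" if "s \<in> B" for s
    using that by (auto simp: B_def support_def dir_def pt_def vec_eq_iff)
  have Q_pt: "Q (pt s)" if "s \<in> B" for s
  proof -
    have "a \<bullet> s = 0" "\<forall>j. e $ j \<le> s $ j + x $ j \<and> s $ j + x $ j \<le> g $ j"
      using that by (auto simp: B_def feasible_directions_def)
    then show ?thesis using inner_dir[of "pt s"] dir_pt[OF that]
      by (auto simp: Q_def) (auto simp: pt_def add.commute)
  qed
  have "compact B"
  proof -
    have "{s::real^'n. support s \<subseteq> S} = (\<Inter>i\<in>-S. {s. s $ i = 0})" by (auto simp: support_def)
    moreover have "closed (\<Inter>i\<in>-S. {s::real^'n. s $ i = 0})"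
      by (intro closed_INT ballI closed_Collect_eq continuous_intros)
    ultimately show ?thesis unfolding B_def by (simp add: compact_Int_closed compact_feasible_directions)
  qed
  moreover have "0 \<in> B" using zero_feasible_direction[OF x] by (simp add: B_def support_def)
  moreover have "continuous_on B model" unfolding model_def by (intro continuous_intros)
  ultimately obtain s0 where s0: "s0 \<in> B" "\<And>s. s \<in> B \<Longrightarrow> model s0 \<le> model s"
    using continuous_attains_inf[of B model] by blast
  have "is_arg_min \<phi> Q (pt s0)"
    unfolding is_arg_min_linorder
  proof (intro conjI allI impI)
    show "Q (pt s0)" using s0(1) by (rule Q_pt)
    fix u assume "Q u"
    then have "model s0 \<le> model (dir u)" by (intro s0 dir_B)
    then show "\<phi> (pt s0) \<le> \<phi> u" using model_dir[of u] model_dir[of "pt s0"] dir_pt[OF s0(1)] by simp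
  qed
  then have am: "is_arg_min \<phi> Q (arg_min \<phi> Q)" by (rule is_arg_min_arg_min)
  have bm: "block_minimizer f L a e g S x = arg_min \<phi> Q"
    unfolding block_minimizer_def \<phi>_def Q_def ..
  have d: "d = dir (arg_min \<phi> Q)" unfolding d_def block_direction_def bm dir_def ..
  have "d \<in> B" unfolding d using am by (intro dir_B) (simp add: is_arg_min_linorder)
  then show "d \<in> feasible_directions a e g x" "support d \<subseteq> S" by (auto simp: B_def)
  fix s assume "s \<in> feasible_directions a e g x" "support s \<subseteq> S"
  then have "s \<in> B" by (simp add: B_def)
  then have "\<phi> (arg_min \<phi> Q) \<le> \<phi> (pt s)" using am Q_pt by (simp add: is_arg_min_linorder)
  then have "model d \<le> model s" using model_dir[of "pt s"] dir_pt[OF \<open>s \<in> B\<close>] by (simp add: d model_dir)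
  then show "grad f x \<bullet> d + L S / 2 * (norm d)\<^sup>2 \<le> grad f x \<bullet> s + L S / 2 * (norm s)\<^sup>2"
    by (simp add: model_def)
qed

definition block_decrease ::
    "(real ^ 'n \<Rightarrow> real) \<Rightarrow> ('n set \<Rightarrow> real) \<Rightarrow> real ^ 'n \<Rightarrow> real ^ 'n \<Rightarrow> real ^ 'n \<Rightarrow>
     real ^ 'n \<Rightarrow> 'n set \<Rightarrow> real" where
  "block_decrease f L a e g x S = f x - f (x + block_direction f L a e g S x)"

lemma block_decrease_ge_model:
  fixes f :: "real ^ 'n \<Rightarrow> real"
  assumes "\<forall>x. f differentiable (at x)" "coord_lipschitz_grad q L f" "S \<in> coord_sets q"
    and "x \<in> feasible_set a b e g" "s \<in> feasible_directions a e g x" "support s \<subseteq> S"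
  shows "- (grad f x \<bullet> s) - L S / 2 * (norm s)\<^sup>2 \<le> block_decrease f L a e g x S"
proof -
  let ?d = "block_direction f L a e g S x"
  have "support ?d \<subseteq> S" by (rule block_direction_minimal(2)[OF assms(4)])
  then have "f (x + ?d) \<le> f x + grad f x \<bullet> ?d + L S / 2 * (norm ?d)\<^sup>2"
    by (rule block_descent[OF assms(1-3)])
  moreover have "grad f x \<bullet> ?d + L S / 2 * (norm ?d)\<^sup>2 \<le> grad f x \<bullet> s + L S / 2 * (norm s)\<^sup>2"
    by (rule block_direction_minimal(3)[OF assms(4-6)])
  ultimately show ?thesis by (simp add: block_decrease_def)
qed

lemma block_decrease_nonneg:
  fixes f :: "real ^ 'n \<Rightarrow> real"
  assumes "\<forall>x. f differentiable (at x)" "coord_lipschitz_grad q L f" "S \<in> coord_sets q"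
    and "x \<in> feasible_set a b e g"
  shows "0 \<le> block_decrease f L a e g x S"
  using block_decrease_ge_model[OF assms zero_feasible_direction[OF assms(4)]]
  by (simp add: support_def)

section \<open>The stationarity measure is bounded by the total decrease\<close>

lemma weighted_norm_sq:
  assumes "\<And>i. 0 \<le> w $ i"
  shows "(weighted_norm w s)\<^sup>2 = (\<Sum>i\<in>UNIV. w $ i * (s $ i)\<^sup>2)"
proof -
  have "s \<bullet> (Diag w *v s) = (\<Sum>i\<in>UNIV. w $ i * (s $ i)\<^sup>2)"
    by (simp add: inner_vec_def Diag_def matrix_vector_mult_def if_distrib[of "\<lambda>z. z * _"]
        power2_eq_square mult.assoc mult.left_commute cong: if_cong)
  moreover have "0 \<le> (\<Sum>i\<in>UNIV. w $ i * (s $ i)\<^sup>2)" using assms by (intro sum_nonneg) simp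
  ultimately show ?thesis by (simp add: weighted_norm_def)
qed

lemma Gamma_vec_pos:
  fixes L :: "'n::finite set \<Rightarrow> real"
  assumes q: "1 \<le> q" "q \<le> CARD('n)" and L: "\<forall>S\<in>coord_sets q. 0 < L S"
  shows "0 < Gamma_vec q L $ i"
proof -
  have "\<exists>S. {i} \<subseteq> S \<and> S \<subseteq> UNIV \<and> card S = q"
    by (rule exists_subset_between) (use q in auto)
  then have "{S \<in> coord_sets q. i \<in> S} \<noteq> {}" by (auto simp: coord_sets_def)
  then have "0 < (\<Sum>S\<in>{S \<in> coord_sets q. i \<in> S}. L S)" using L by (intro sum_pos) auto
  moreover have "0 < mu_const TYPE('n) q" using q by (simp add: mu_const_def)
  ultimately show ?thesis by (simp add: Gamma_vec_def)
qed

lemma full_direction_minimal: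
  fixes x :: "real ^ 'n" and f :: "real ^ 'n \<Rightarrow> real" and \<mu> :: real
  assumes x: "x \<in> feasible_set a b e g" and w: "\<And>i. 0 \<le> w $ i"
  defines "d \<equiv> full_direction f a e g \<mu> w x"
  shows "d \<in> feasible_directions a e g x"
    and "\<And>s. s \<in> feasible_directions a e g x \<Longrightarrow> psi f \<mu> w d x \<le> psi f \<mu> w s x"
proof -
  let ?F = "feasible_directions a e g x"
  have "continuous_on ?F (\<lambda>s. psi f \<mu> w s x)"
    unfolding psi_def weighted_norm_sq[OF w] by (intro continuous_intros)
  then obtain s0 where "s0 \<in> ?F" "\<forall>s\<in>?F. psi f \<mu> w s0 x \<le> psi f \<mu> w s x"
    using continuous_attains_inf[of ?F "\<lambda>s. psi f \<mu> w s x"]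
      compact_feasible_directions zero_feasible_direction[OF x] by blast
  then have "is_arg_min (\<lambda>s. psi f \<mu> w s x) (\<lambda>s. s \<in> ?F) s0" by (simp add: is_arg_min_linorder)
  from is_arg_min_arg_min[OF this]
  have "is_arg_min (\<lambda>s. psi f \<mu> w s x) (\<lambda>s. s \<in> ?F) d"
    unfolding d_def full_direction_def .
  then show "d \<in> ?F" "\<And>s. s \<in> ?F \<Longrightarrow> psi f \<mu> w d x \<le> psi f \<mu> w s x"
    by (simp_all add: is_arg_min_linorder)
qed

definition total_decrease ::
    "(real ^ 'n \<Rightarrow> real) \<Rightarrow> ('n set \<Rightarrow> real) \<Rightarrow> real ^ 'n \<Rightarrow> real ^ 'n \<Rightarrow> real ^ 'n \<Rightarrow>
     nat \<Rightarrow> real ^ 'n \<Rightarrow> real" where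
  "total_decrease f L a e g q x = (\<Sum>S\<in>coord_sets q. block_decrease f L a e g x S)"

text \<open>
  Let \<open>d\<close> be the full direction at \<open>x\<close>.  Any conformal piece \<open>s\<close> of \<open>d\<close> with at most two
  nonzero entries lies in some block \<open>S\<close>, and testing the block model at \<open>t * s\<close> with
  \<open>0 < t \<le> 1\<close> gives \<open>- \<langle>\<nabla>f(x), s\<rangle> \<le> \<Lambda>/2 * t * (norm d)\<^sup>2 + D(x) / t\<close>, where \<open>\<Lambda>\<close> bounds
  all \<open>L S\<close> and \<open>D\<close> is the total decrease.  Adding up at most \<open>n\<close> pieces bounds
  \<open>- \<langle>\<nabla>f(x), d\<rangle>\<close>, which is itself at least \<open>\<mu>/2 * M_q(x)\<^sup>2\<close>.  The scale \<open>t\<close> is chosen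
  independently of \<open>x\<close> so that the quadratic remainder takes up at most half of this lower bound.
\<close>
lemma stationarity_le_total_decrease:
  fixes f :: "real ^ 'n \<Rightarrow> real" and a e g :: "real ^ 'n"
  assumes q: "2 \<le> q" "q \<le> CARD('n)"
    and diff: "\<forall>x. f differentiable (at x)" and lip: "coord_lipschitz_grad q L f"
  shows "\<exists>C. \<forall>x\<in>feasible_set a b e g.
           (stationarity_measure f a e g q (Gamma_vec q L) x)\<^sup>2 \<le> C * total_decrease f L a e g q x"
proof -
  define n where "n = real CARD('n)"
  define \<mu> where "\<mu> = mu_const TYPE('n) q"
  define w :: "real ^ 'n" where "w = Gamma_vec q L"
  define \<gamma> where "\<gamma> = Min (range (($) w))"
  define \<Lambda> where "\<Lambda> = (\<Sum>S\<in>coord_sets q. L S)"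
  define t where "t = min 1 (\<mu> * \<gamma> / (2 * n * \<Lambda>))"
  have L_pos: "\<forall>S\<in>coord_sets q. 0 < L S" using lip by (auto simp: coord_lipschitz_grad_def)
  have w_pos: "0 < w $ i" for i unfolding w_def by (rule Gamma_vec_pos) (use q L_pos in auto)
  then have w_nonneg: "\<And>i. 0 \<le> w $ i" by (simp add: less_imp_le)
  have "0 < \<mu>" using q by (simp add: \<mu>_def mu_const_def)
  have "0 < n" by (simp add: n_def)
  have "0 < \<gamma>" using w_pos by (simp add: \<gamma>_def)
  have L_le: "L S \<le> \<Lambda>" if "S \<in> coord_sets q" for S
    unfolding \<Lambda>_def by (rule member_le_sum) (use that L_pos less_imp_le in auto)
  obtain S0 :: "'n set" where "card S0 = q" using obtain_subset_with_card_n[OF q(2)] by blast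
  then have "0 < \<Lambda>" using L_le[of S0] L_pos by (auto simp: coord_sets_def)
  have t: "0 < t" "t \<le> 1" "2 * n * \<Lambda> * t \<le> \<mu> * \<gamma>"
  proof -
    show "0 < t" "t \<le> 1" using \<open>0 < \<mu>\<close> \<open>0 < n\<close> \<open>0 < \<gamma>\<close> \<open>0 < \<Lambda>\<close> by (auto simp: t_def)
    have "t \<le> \<mu> * \<gamma> / (2 * n * \<Lambda>)" by (simp add: t_def)
    then show "2 * n * \<Lambda> * t \<le> \<mu> * \<gamma>"
      using \<open>0 < n\<close> \<open>0 < \<Lambda>\<close> by (simp add: pos_le_divide_eq mult.commute mult.left_commute)
  qed
  have main: "(stationarity_measure f a e g q w x)\<^sup>2 \<le> (4 * n / (\<mu> * t)) * total_decrease f L a e g q x"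
    if x: "x \<in> feasible_set a b e g" for x
  proof -
    let ?\<Delta> = "total_decrease f L a e g q x"
    define d where "d = full_direction f a e g \<mu> w x"
    have d: "d \<in> feasible_directions a e g x"
      unfolding d_def by (rule full_direction_minimal(1)[OF x w_nonneg])
    have "psi f \<mu> w d x \<le> psi f \<mu> w 0 x"
      unfolding d_def by (rule full_direction_minimal(2)[OF x w_nonneg zero_feasible_direction[OF x]])
    then have lower: "\<mu> / 2 * (weighted_norm w d)\<^sup>2 \<le> - (grad f x \<bullet> d)"
      by (simp add: psi_def weighted_norm_def)
    have \<Delta>_ge: "block_decrease f L a e g x S \<le> ?\<Delta>" if "S \<in> coord_sets q" for S
      unfolding total_decrease_def
      by (rule member_le_sum) (use that block_decrease_nonneg[OF diff lip _ x] in auto)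
    have \<Delta>_nonneg: "0 \<le> ?\<Delta>"
      unfolding total_decrease_def by (intro sum_nonneg block_decrease_nonneg[OF diff lip _ x])
    have piece: "- (grad f x \<bullet> s) \<le> \<Lambda> / 2 * t * (norm d)\<^sup>2 + ?\<Delta> / t"
      if s: "a \<bullet> s = 0" "conformal s d" "card (support s) \<le> 2" for s
    proof -
      obtain S where S: "support s \<subseteq> S" "card S = q"
        using exists_subset_between[of "support s" q UNIV] s(3) q by auto
      then have S': "S \<in> coord_sets q" by (simp add: coord_sets_def)
      have "t *\<^sub>R s = (\<chi> i. t * s $ i)" by (simp add: vec_eq_iff)
      then have "conformal (t *\<^sub>R s) s"
        using conformal_coordinate_scaling[of "\<lambda>_. t" s] t by simp
      then have "t *\<^sub>R s \<in> feasible_directions a e g x"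
        using s conformal_feasible_direction[OF conformal_trans _ x d] by simp
      moreover have "support (t *\<^sub>R s) \<subseteq> S" using S by (auto simp: support_def)
      ultimately have "- (grad f x \<bullet> (t *\<^sub>R s)) - L S / 2 * (norm (t *\<^sub>R s))\<^sup>2
          \<le> block_decrease f L a e g x S"
        by (rule block_decrease_ge_model[OF diff lip S' x])
      then have "t * - (grad f x \<bullet> s) \<le> L S / 2 * (t * norm s)\<^sup>2 + ?\<Delta>"
        using \<Delta>_ge[OF S'] t(1) by simp
      also have "L S / 2 * (t * norm s)\<^sup>2 \<le> \<Lambda> / 2 * (t * norm d)\<^sup>2"
        using L_le[OF S'] L_pos S' t(1) conformal_norm_le[OF s(2)] \<open>0 < \<Lambda>\<close>
        by (intro mult_mono power_mono) auto
      finally have "t * - (grad f x \<bullet> s) \<le> \<Lambda> / 2 * (t * norm d)\<^sup>2 + ?\<Delta>" by simp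
      also have "\<dots> = t * (\<Lambda> / 2 * t * (norm d)\<^sup>2 + ?\<Delta> / t)"
        using t(1) by (simp add: field_simps power2_eq_square)
      finally show ?thesis using t(1) by (rule mult_left_le_imp_le)
    qed
    define K where "K = \<Lambda> / 2 * t * (norm d)\<^sup>2 + ?\<Delta> / t"
    have "0 \<le> K" unfolding K_def using \<open>0 < \<Lambda>\<close> t(1) \<Delta>_nonneg by simp
    have "a \<bullet> d = 0" using d by (simp add: feasible_directions_def)
    then obtain ss where ss: "length ss \<le> card (support d)" "sum_list ss = d"
      "\<forall>s\<in>set ss. a \<bullet> s = 0 \<and> conformal s d \<and> card (support s) \<le> 2"
      using conformal_decomposition by blast
    have "\<forall>s\<in>set rs. - (grad f x \<bullet> s) \<le> K \<Longrightarrow> - (grad f x \<bullet> sum_list rs) \<le> real (length rs) * K" for rs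
    proof (induction rs)
      case (Cons r rs)
      then have "- (grad f x \<bullet> r) \<le> K" "- (grad f x \<bullet> sum_list rs) \<le> real (length rs) * K" by simp_all
      then show ?case by (simp add: inner_add_right distrib_right)
    qed simp
    moreover have "\<forall>s\<in>set ss. - (grad f x \<bullet> s) \<le> K" using ss(3) piece by (simp add: K_def)
    ultimately have "- (grad f x \<bullet> d) \<le> real (length ss) * K" using ss(2) by metis
    also have "\<dots> \<le> n * K"
      using ss(1) card_mono[of UNIV "support d"] \<open>0 \<le> K\<close>
      by (intro mult_right_mono) (auto simp: n_def)
    finally have upper: "- (grad f x \<bullet> d) \<le> n * K" .
    have coercive: "\<gamma> * (norm d)\<^sup>2 \<le> (weighted_norm w d)\<^sup>2"
    proof -
      have "\<gamma> * (norm d)\<^sup>2 = (\<Sum>i\<in>UNIV. \<gamma> * (d $ i)\<^sup>2)"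
        unfolding power2_norm_eq_inner by (simp add: inner_vec_def sum_distrib_left power2_eq_square)
      also have "\<dots> \<le> (\<Sum>i\<in>UNIV. w $ i * (d $ i)\<^sup>2)"
        by (intro sum_mono mult_right_mono) (auto simp: \<gamma>_def)
      finally show ?thesis by (simp add: weighted_norm_sq[OF w_nonneg])
    qed
    have "n * K = (2 * n * \<Lambda> * t) * (norm d)\<^sup>2 / 4 + n * ?\<Delta> / t" by (simp add: K_def algebra_simps)
    also have "\<dots> \<le> (\<mu> * \<gamma>) * (norm d)\<^sup>2 / 4 + n * ?\<Delta> / t"
      using mult_right_mono[OF t(3) zero_le_power2[of "norm d"]] by linarith
    also have "\<dots> \<le> \<mu> * (weighted_norm w d)\<^sup>2 / 4 + n * ?\<Delta> / t"
      using mult_left_mono[OF coercive, of \<mu>] \<open>0 < \<mu>\<close> by (simp add: mult.assoc)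
    finally have "\<mu> * (weighted_norm w d)\<^sup>2 / 4 \<le> n * ?\<Delta> / t" using lower upper by linarith
    then have "(weighted_norm w d)\<^sup>2 \<le> (4 * n / (\<mu> * t)) * ?\<Delta>"
      using \<open>0 < \<mu>\<close> t(1) by (simp add: field_simps)
    then show ?thesis by (simp add: stationarity_measure_def d_def \<mu>_def)
  qed
  then show ?thesis unfolding w_def by blast
qed

section \<open>Probabilistic tools\<close>

text \<open>
  By monotone convergence the pathwise series has finite expectation, hence is finite
  almost everywhere, and the terms of a convergent series tend to zero.
\<close>
lemma (in prob_space) AE_tendsto_zero_if_expectations_summable:
  fixes Y :: "nat \<Rightarrow> 'a \<Rightarrow> real"
  assumes int: "\<And>m. integrable M (Y m)" and nonneg: "\<And>m \<omega>. 0 \<le> Y m \<omega>"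
    and bound: "\<And>k. (\<Sum>m<k. expectation (Y m)) \<le> B"
  shows "AE \<omega> in M. (\<lambda>m. Y m \<omega>) \<longlonglongrightarrow> 0"
proof -
  have [measurable]: "\<And>m. Y m \<in> borel_measurable M" using int by auto
  have "(\<integral>\<^sup>+\<omega>. (\<Sum>m. ennreal (Y m \<omega>)) \<partial>M) = (\<Sum>m. \<integral>\<^sup>+\<omega>. ennreal (Y m \<omega>) \<partial>M)"
    by (rule nn_integral_suminf) measurable
  also have "\<dots> = (\<Sum>m. ennreal (expectation (Y m)))"
    by (intro suminf_cong nn_integral_eq_integral int AE_I2 nonneg)
  also have "\<dots> \<le> ennreal B"
  proof (rule suminf_le_const[OF summableI])
    fix k
    have "(\<Sum>m<k. ennreal (expectation (Y m))) = ennreal (\<Sum>m<k. expectation (Y m))"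
      by (intro sum_ennreal integral_nonneg_AE AE_I2 nonneg)
    also have "\<dots> \<le> ennreal B" by (intro ennreal_leI bound)
    finally show "(\<Sum>m<k. ennreal (expectation (Y m))) \<le> ennreal B" .
  qed
  finally have "(\<integral>\<^sup>+\<omega>. (\<Sum>m. ennreal (Y m \<omega>)) \<partial>M) < \<infinity>"
    using ennreal_less_top le_less_trans by (metis infinity_ennreal_def)
  then have "AE \<omega> in M. (\<Sum>m. ennreal (Y m \<omega>)) \<noteq> \<infinity>"
    by (intro nn_integral_PInf_AE) auto
  then show ?thesis
  proof eventually_elim
    case (elim \<omega>)
    then have "summable (\<lambda>m. Y m \<omega>)" by (intro summable_suminf_not_top nonneg) simp
    then show ?case by (rule summable_LIMSEQ_zero)
  qed
qed

text \<open>
  A random index drawn uniformly from \<open>A\<close> selects each \<open>Y s\<close> with weight \<open>1 / card A\<close>, provided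
  the event that \<open>s\<close> is drawn is independent of \<open>Y s\<close>: decompose over the value of the
  index and factor each expectation.  This replaces conditioning on the past in the analysis of the
  algorithm.
\<close>
lemma (in prob_space) expectation_uniform_draw:
  fixes K :: "'a \<Rightarrow> 's::finite" and Y :: "'s \<Rightarrow> 'a \<Rightarrow> real"
  assumes K [measurable]: "K \<in> measurable M (count_space UNIV)"
    and unif: "distr M (count_space UNIV) K = measure_pmf (pmf_of_set A)" and A: "A \<noteq> {}"
    and int: "\<And>s. integrable M (Y s)"
    and indep: "\<And>s. indep_var borel (\<lambda>\<omega>. indicator {s} (K \<omega>)) borel (Y s)"
  shows "real (card A) * expectation (\<lambda>\<omega>. Y (K \<omega>) \<omega>) = (\<Sum>s\<in>A. expectation (Y s))"
proof -
  define I where "I s \<omega> = (indicator {s} (K \<omega>) :: real)" for s \<omega>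
  have indep': "indep_var borel (I s) borel (Y s)" for s
    using indep[of s] by (simp add: I_def[abs_def])
  have I_int: "integrable M (I s)" for s
    unfolding I_def by (rule integrable_const_bound[of _ 1]) auto
  have I_exp: "expectation (I s) = (if s \<in> A then 1 / card A else 0)" for s
  proof -
    have "expectation (I s) = (\<integral>k. indicator {s} k \<partial>distr M (count_space UNIV) K)"
      unfolding I_def by (subst integral_distr) auto
    also have "\<dots> = pmf (pmf_of_set A) s" by (simp add: unif pmf.rep_eq)
    finally show ?thesis using A by (simp add: indicator_def)
  qed
  have prod_int: "integrable M (\<lambda>\<omega>. I s \<omega> * Y s \<omega>)" for s
    by (rule indep_var_integrable[OF indep' I_int int])
  have "Y (K \<omega>) \<omega> = (\<Sum>s\<in>UNIV. I s \<omega> * Y s \<omega>)" for \<omega>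
    by (simp add: I_def indicator_def if_distrib[of "\<lambda>z. z * _"] cong: if_cong)
  then have "expectation (\<lambda>\<omega>. Y (K \<omega>) \<omega>) = (\<Sum>s\<in>UNIV. expectation (\<lambda>\<omega>. I s \<omega> * Y s \<omega>))"
    by (simp add: Bochner_Integration.integral_sum[OF prod_int])
  also have "\<dots> = (\<Sum>s\<in>UNIV. expectation (I s) * expectation (Y s))"
    by (simp add: indep_var_lebesgue_integral[OF indep' I_int int])
  also have "\<dots> = (\<Sum>s\<in>A. expectation (Y s) / card A)"
    by (rule sum.mono_neutral_cong_right) (auto simp: I_exp)
  finally show ?thesis using A by (simp add: sum_divide_distrib[symmetric] card_eq_0_iff)
qed

section \<open>Convergence of the algorithm\<close>

lemma rccd_cong:
  "(\<And>k. k < m \<Longrightarrow> Js k = Js' k) \<Longrightarrow> rccd f L a e g x0 Js m = rccd f L a e g x0 Js' m"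
  by (induction m) auto

lemma rccd_feasible:
  "x0 \<in> feasible_set a b e g \<Longrightarrow> rccd f L a e g x0 Js m \<in> feasible_set a b e g"
  by (induction m) (auto intro: feasible_step block_direction_minimal(1))

theorem theorem4p9:
  fixes f :: "real ^ 'n \<Rightarrow> real"
    and a e g x0 :: "real ^ 'n"
    and b :: real
    and q :: nat
    and L :: "'n set \<Rightarrow> real"
    and M :: "'w measure"
    and J :: "nat \<Rightarrow> 'w \<Rightarrow> 'n set"
    and X :: "nat \<Rightarrow> 'w \<Rightarrow> real ^ 'n"
  assumes q_range: "2 \<le> q" "q < CARD('n)"
    and bounds: "\<forall>i. e $ i \<le> g $ i"
    and differentiable: "\<forall>x. f differentiable (at x)"
    and lipschitz: "coord_lipschitz_grad q L f"
    and start: "x0 \<in> feasible_set a b e g"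
    and prob: "prob_space M"
    and independent: "prob_space.indep_vars M (\<lambda>_. count_space UNIV) J UNIV"
    and uniform: "\<forall>m. distr M (count_space UNIV) (J m) = measure_pmf (pmf_of_set (coord_sets q))"
    and iterates: "\<forall>m \<omega>. X m \<omega> = rccd f L a e g x0 (\<lambda>k. J k \<omega>) m"
  shows "(\<exists>fbar \<in> borel_measurable M.
            AE \<omega> in M. (\<lambda>m. f (X m \<omega>)) \<longlonglongrightarrow> (fbar \<omega> :: real))
       \<and> (AE \<omega> in M.
            (\<lambda>m. stationarity_measure f a e g q (Gamma_vec q L) (X m \<omega>)) \<longlonglongrightarrow> 0)"
proof -
  interpret prob_space M by (rule prob)
  let ?P = "feasible_set a b e g"
  let ?dec = "block_decrease f L a e g"
  let ?D = "total_decrease f L a e g q"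
  have X_feasible: "X m \<omega> \<in> ?P" for m \<omega>
    using rccd_feasible[OF start] by (simp add: iterates)
  have X_Suc: "X (Suc m) \<omega> = X m \<omega> + block_direction f L a e g (J m \<omega>) (X m \<omega>)" for m \<omega>
    by (simp add: iterates)
  have step_decrease: "?dec (X m \<omega>) (J m \<omega>) = f (X m \<omega>) - f (X (Suc m) \<omega>)" for m \<omega>
    by (simp add: block_decrease_def X_Suc)
  have blocks_ne: "(coord_sets q :: 'n set set) \<noteq> {}"
    using obtain_subset_with_card_n[of q "UNIV :: 'n set"] q_range by (auto simp: coord_sets_def)
  have "continuous_on ?P f"
    using differentiable by (intro continuous_at_imp_continuous_on) (auto intro: differentiable_imp_continuous_within)
  then have "bounded (f ` ?P)" by (intro compact_imp_bounded compact_continuous_image compact_feasible_set)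
  then obtain B where B: "\<And>x. x \<in> ?P \<Longrightarrow> \<bar>f x\<bar> \<le> B" by (auto simp: bounded_iff)
  have dec_bound: "\<bar>?dec x S\<bar> \<le> 2 * B" if "x \<in> ?P" for x S
    using B[OF that] B[OF feasible_step[OF that block_direction_minimal(1)[OF that]], of f L S]
    by (simp add: block_decrease_def)

  \<comment> \<open>The first \<open>m\<close> draws take finitely many joint values, so every function of them is measurable.
     Through this history \<open>X m\<close> is seen to be independent of the draw \<open>J m\<close>.\<close>
  define H where "H m \<omega> = restrict (\<lambda>k. J k \<omega>) {..<m}" for m \<omega>
  have X_H: "X m \<omega> = rccd f L a e g x0 (H m \<omega>) m" for m \<omega>
    unfolding iterates[rule_format] by (rule rccd_cong) (simp add: H_def)
  have J_meas [measurable]: "J m \<in> measurable M (count_space UNIV)" for m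
    using independent by (simp add: indep_vars_def)
  have H_meas: "H m \<in> measurable M (PiM {..<m} (\<lambda>_. count_space UNIV))" for m
    unfolding H_def by measurable
  have history_meas: "h \<in> borel_measurable (PiM {..<m} (\<lambda>_. count_space (UNIV :: 'n set set)))"
    for m and h :: "(nat \<Rightarrow> 'n set) \<Rightarrow> real"
    by (subst count_space_PiM_finite) (auto simp: uncountable_infinite)
  have X_meas: "(\<lambda>\<omega>. h (X m \<omega>)) \<in> borel_measurable M" for h :: "real ^ 'n \<Rightarrow> real" and m
    unfolding X_H
    by (rule measurable_compose[OF H_meas history_meas[of "\<lambda>r. h (rccd f L a e g x0 r m)"]])
  have indep: "indep_var borel (\<lambda>\<omega>. indicator {S} (J m \<omega>)) borel (\<lambda>\<omega>. h (X m \<omega>))"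
    for S m and h :: "real ^ 'n \<Rightarrow> real"
  proof -
    have "indep_var (PiM {m} (\<lambda>_. count_space UNIV)) (\<lambda>\<omega>. restrict (\<lambda>k. J k \<omega>) {m})
        (PiM {..<m} (\<lambda>_. count_space UNIV)) (H m)"
      unfolding H_def by (rule indep_var_restrict[OF independent]) auto
    then have "indep_var borel ((\<lambda>r. indicator {S} (r m)) \<circ> (\<lambda>\<omega>. restrict (\<lambda>k. J k \<omega>) {m}))
        borel ((\<lambda>r. h (rccd f L a e g x0 r m)) \<circ> H m)"
      by (rule indep_var_compose[OF _ _ history_meas]) measurable
    then show ?thesis by (simp add: comp_def X_H)
  qed
  have f_int: "integrable M (\<lambda>\<omega>. f (X m \<omega>))" for m
    by (rule integrable_const_bound[of _ B]) (auto simp: B X_feasible X_meas)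
  have dec_int: "integrable M (\<lambda>\<omega>. ?dec (X m \<omega>) S)" for m S
    by (rule integrable_const_bound[of _ "2 * B"])
      (auto simp: dec_bound X_feasible intro: X_meas[of "\<lambda>x. ?dec x S"])
  have D_int: "integrable M (\<lambda>\<omega>. ?D (X m \<omega>))" for m
    unfolding total_decrease_def by (intro Bochner_Integration.integrable_sum dec_int)
  have D_nonneg: "0 \<le> ?D (X m \<omega>)" for m \<omega>
    unfolding total_decrease_def
    by (intro sum_nonneg block_decrease_nonneg[OF differentiable lipschitz _ X_feasible])

  define N where "N = real (card (coord_sets q :: 'n set set))"
  have D_exp: "expectation (\<lambda>\<omega>. ?D (X m \<omega>))
      = N * (expectation (\<lambda>\<omega>. f (X m \<omega>)) - expectation (\<lambda>\<omega>. f (X (Suc m) \<omega>)))" for m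
  proof -
    have "N * expectation (\<lambda>\<omega>. ?dec (X m \<omega>) (J m \<omega>))
        = (\<Sum>S\<in>coord_sets q. expectation (\<lambda>\<omega>. ?dec (X m \<omega>) S))"
      unfolding N_def
      by (rule expectation_uniform_draw[OF J_meas uniform[rule_format] blocks_ne dec_int indep])
    then have "N * expectation (\<lambda>\<omega>. ?dec (X m \<omega>) (J m \<omega>)) = expectation (\<lambda>\<omega>. ?D (X m \<omega>))"
      by (simp add: total_decrease_def Bochner_Integration.integral_sum[OF dec_int])
    then show ?thesis by (simp add: step_decrease Bochner_Integration.integral_diff[OF f_int f_int])
  qed
  have "(\<Sum>m<k. expectation (\<lambda>\<omega>. ?D (X m \<omega>))) \<le> 2 * N * B" for k
  proof -
    have exp_bound: "\<bar>expectation (\<lambda>\<omega>. f (X m \<omega>))\<bar> \<le> B" for m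
    proof -
      have "expectation (\<lambda>\<omega>. f (X m \<omega>)) \<le> B" "- B \<le> expectation (\<lambda>\<omega>. f (X m \<omega>))"
        using B[OF X_feasible] by (auto intro!: integral_le_const integral_ge_const f_int AE_I2 simp: abs_le_iff minus_le_iff)
      then show ?thesis by simp
    qed
    have "(\<Sum>m<k. expectation (\<lambda>\<omega>. ?D (X m \<omega>)))
        = N * (expectation (\<lambda>\<omega>. f (X 0 \<omega>)) - expectation (\<lambda>\<omega>. f (X k \<omega>)))"
      unfolding D_exp sum_distrib_left[symmetric]
      using sum_lessThan_telescope'[of "\<lambda>m. expectation (\<lambda>\<omega>. f (X m \<omega>))" k] by (rule arg_cong)
    also have "\<dots> \<le> N * (2 * B)"
      using exp_bound[of 0] exp_bound[of k] by (intro mult_left_mono) (auto simp: N_def)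
    finally show ?thesis by simp
  qed
  then have D_lim: "AE \<omega> in M. (\<lambda>m. ?D (X m \<omega>)) \<longlonglongrightarrow> 0"
    by (rule AE_tendsto_zero_if_expectations_summable[OF D_int D_nonneg])

  obtain C where C: "\<And>x. x \<in> ?P \<Longrightarrow>
      (stationarity_measure f a e g q (Gamma_vec q L) x)\<^sup>2 \<le> C * ?D x"
    using stationarity_le_total_decrease[OF q_range(1) _ differentiable lipschitz] q_range(2)
    by (metis less_imp_le)
  have "AE \<omega> in M. (\<lambda>m. stationarity_measure f a e g q (Gamma_vec q L) (X m \<omega>)) \<longlonglongrightarrow> 0"
    using D_lim
  proof eventually_elim
    case (elim \<omega>)
    let ?M = "\<lambda>m. stationarity_measure f a e g q (Gamma_vec q L) (X m \<omega>)"
    have "(\<lambda>m. C * ?D (X m \<omega>)) \<longlonglongrightarrow> 0" using tendsto_mult_right_zero[OF elim] .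
    then have "(\<lambda>m. (?M m)\<^sup>2) \<longlonglongrightarrow> 0"
      by (rule tendsto_sandwich[OF _ _ tendsto_const, rotated 2]) (auto simp: C X_feasible)
    then show ?case by (rule power_tendsto_0_iff[THEN iffD1, rotated]) simp
  qed
  \<comment> \<open>A draw may leave the family of blocks on a null set, where the decrease could be negative.\<close>
  moreover have "AE \<omega> in M. \<forall>m. J m \<omega> \<in> coord_sets q"
  proof -
    have "AE \<omega> in M. J m \<omega> \<in> coord_sets q" for m
    proof -
      have "AE S in distr M (count_space UNIV) (J m). S \<in> coord_sets q"
        unfolding uniform[rule_format] using blocks_ne by (simp add: AE_measure_pmf_iff)
      then show ?thesis by (subst (asm) AE_distr_iff) auto
    qed
    then show ?thesis by (simp add: AE_all_countable)
  qed
  then have "AE \<omega> in M. (\<lambda>m. f (X m \<omega>)) \<longlonglongrightarrow> lim (\<lambda>m. f (X m \<omega>))"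
  proof eventually_elim
    case (elim \<omega>)
    have "f (X (Suc m) \<omega>) \<le> f (X m \<omega>)" for m
      using block_decrease_nonneg[OF differentiable lipschitz elim[rule_format, of m] X_feasible[of m \<omega>]]
      by (simp add: step_decrease)
    then have "decseq (\<lambda>m. f (X m \<omega>))" by (rule decseq_SucI)
    moreover have "\<forall>m. - B \<le> f (X m \<omega>)" using B[OF X_feasible] by (metis abs_le_D2 minus_le_iff)
    ultimately have "convergent (\<lambda>m. f (X m \<omega>))" by (metis decseq_convergent convergentI)
    then show ?case by (simp add: convergent_LIMSEQ_iff)
  qed
  moreover have "(\<lambda>\<omega>. lim (\<lambda>m. f (X m \<omega>))) \<in> borel_measurable M"
    by (rule borel_measurable_lim_metric) (rule X_meas)
  ultimately show ?thesis by (intro conjI bexI[of _ "\<lambda>\<omega>. lim (\<lambda>m. f (X m \<omega>))"])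
qed

end
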